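(* Let $\mathcal{C}=\mathrm{Corridor}(u,l,D)$ be an $\mathbb{R}^m$-corridor, let $X\subset D$ be a finite set, and let $H=(X,E)$ be an incompatibility hypergraph for $\mathcal{C}$. Then the optimal value (minimum number of colors) of problem $(\mathcal{R}^{\mathrm{DCFP}})$ for $(\mathcal{C},X,H)$ is a lower bound on the optimal value of the Corridor Fitting Problem in $\mathbb{R}^m$ on $\mathcal{C}$, i.e. on the minimum number of pieces of a piecewise linear function $g$ with domain $D$ satisfying $l(x)\le g(x)\le u(x)$ for all $x\in D$.
   Context: "Linear function" means affine function $x\mapsto a^Tx+b$ with $a\in\mathbb{R}^m$, $b\in\mathbb{R}$. Polytopes are compact; $\mathrm{int}$, $\mathrm{bd}$ and $\mathrm{conv}$ denote interior, boundary and convex hull. Corridor: let $D\subset\mathbb{R}^m$ be a full-dimensional polytope and $u,l:D\to\mathbb{R}$ continuous functions with $l(x)<u(x)$ for all $x\in D$. The $\mathbb{R}^m$-corridor between $u$ and $l$ of domain $D$ is $\mathrm{Corridor}(u,l,D)=\{(x,z)\in\mathbb{R}^{m+1} : x\in D,\ l(x)\le z\le u(x)\}$ (given together with the data $u,l,D$). Piecewise linear function with $n$ pieces and domain $D$ ($n\ge 1$ an integer): given full-dimensional polytopes $D_1,\dots,D_n\subset\mathbb{R}^m$ covering $D$ with pairwise disjoint interiors, and linear functions $l_i:D_i\to\mathbb{R}$, it is the function $g$ on $D$ with $g(x)=l_i(x)$ if $x\in\mathrm{int}(D_i)$, and, if $x$ lies on the boundary of some $D_i$, $g(x)=\min\{l_i(x):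 i \text{ with } x\in D_i\}$. Corridor Fitting Problem in $\mathbb{R}^m$ ($\mathbb{R}^m$-CFP) on $\mathrm{Corridor}(u,l,D)$: find a piecewise linear function $g$ with domain $D$ with the minimum number $n$ of pieces subject to $l(x)\le g(x)\le u(x)$ for all $x\in D$. Its optimal value is this minimum number of pieces. Linearly compatible set: a finite set $s\subset D$ is linearly compatible (for $\mathrm{Corridor}(u,l,D)$) if there is a linear function $L$ with $l(x)\le L(x)\le u(x)$ for all $x\in\mathrm{conv}(s)$; otherwise it is not linearly compatible. Hypergraph and coloring: a hypergraph $(V,E)$ has a finite vertex set $V$ and a set $E$ of edges, each edge being a subset of $V$ (possibly with more than two vertices). An $n$-coloring of $(V,E)$ is a function $c:V\to\{1,\dots,n\}$ such that for every edge $e\in E$ not all vertices of $e$ have the same color. Incompatibility hypergraph for $\mathcal{C}$: a hypergraph $H=(X,E)$ with $X\subset D$ finite, each of whose edges is a subset of $X$ that is not linearly compatible for $\mathcal{C}$ (not every such subset needs to be an edge). Problem $(\mathcal{R}^{\mathrm{DCFP}})$: find a coloring of $H$ (i.e. an $n$-coloring $c:X\to\{1,\dots,n\}$ such that for every edge $e\in E$ not all vertices of $e$ have the same color) minimizing the number of colors, subject to: (i) each color $j$ is associated with a linear function $L_j(x)=a_jx+b_j$, $a_j\in\mathbb{R}^m$, $b_j\in\mathbb{R}$, defined on the domain $D_j=\mathrm{conv}(\{x_i\in X : x_i \text{ is of color } j\})$; (ii) the interiors of the domains $D_j$ do not intersect; (iii) each point $x_i\in X$ of color $j$ satisfies $l(x_i)\le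 L_j(x_i)\le u(x_i)$. *)

theory Defs
  imports "HOL-Analysis.Analysis" "HOL-Library.Extended_Nat"
begin

definition full_dim_polytope :: "(real ^ 'm) set \<Rightarrow> bool" where
  "full_dim_polytope P \<longleftrightarrow> polytope P \<and> aff_dim P = int DIM(real ^ 'm)"

text \<open>``Linear'' means affine here.\<close>

definition linear_function :: "(real ^ 'm \<Rightarrow> real) \<Rightarrow> bool" where
  "linear_function L \<longleftrightarrow> (\<exists>a b. L = (\<lambda>x. a \<bullet> x + b))"

text \<open>A corridor is given by its data: upper bound \<open>u\<close>, lower bound \<open>l\<close> and domain \<open>D\<close>.
  The functions \<open>u\<close> and \<open>l\<close> are total, but only their values on \<open>D\<close> matter.\<close>

definition corridor :: "(real ^ 'm \<Rightarrow> real) \<Rightarrow> (real ^ 'm \<Rightarrow> real) \<Rightarrow> (real ^ 'm) set \<Rightarrow> bool" where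
  "corridor u l D \<longleftrightarrow> full_dim_polytope D \<and> continuous_on D u \<and> continuous_on D l \<and>
     (\<forall>x\<in>D. l x < u x)"

text \<open>The pieces have to cover \<open>D\<close>, but are not required to be contained in \<open>D\<close>.\<close>

definition piecewise_linear :: "nat \<Rightarrow> (real ^ 'm) set \<Rightarrow> (real ^ 'm \<Rightarrow> real) \<Rightarrow> bool" where
  "piecewise_linear n D g \<longleftrightarrow> n \<ge> 1 \<and>
     (\<exists>P L. (\<forall>i\<in>{1..n}. full_dim_polytope (P i) \<and> linear_function (L i)) \<and>
        D \<subseteq> (\<Union>i\<in>{1..n}. P i) \<and>
        disjoint_family_on (\<lambda>i. interior (P i)) {1..n} \<and>
        (\<forall>x\<in>D.
           (\<forall>i\<in>{1..n}. x \<in> interior (P i) \<longrightarrow> g x = L i x) \<and>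
           ((\<exists>i\<in>{1..n}. x \<in> frontier (P i)) \<longrightarrow>
              g x = Min {L i x |i. i \<in> {1..n} \<and> x \<in> P i})))"

definition CFP_feasible ::
  "(real ^ 'm \<Rightarrow> real) \<Rightarrow> (real ^ 'm \<Rightarrow> real) \<Rightarrow> (real ^ 'm) set \<Rightarrow> nat \<Rightarrow> (real ^ 'm \<Rightarrow> real) \<Rightarrow> bool" where
  "CFP_feasible u l D n g \<longleftrightarrow> piecewise_linear n D g \<and> (\<forall>x\<in>D. l x \<le> g x \<and> g x \<le> u x)"

text \<open>Optimal values are taken in \<^typ>\<open>enat\<close>, so that an infeasible problem has value \<open>\<infinity>\<close>
  and the infimum over a nonempty set of numbers is its minimum.\<close>

definition CFP_value ::
  "(real ^ 'm \<Rightarrow> real) \<Rightarrow> (real ^ 'm \<Rightarrow> real) \<Rightarrow> (real ^ 'm) set \<Rightarrow> enat" where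
  "CFP_value u l D = (INF n\<in>{n. \<exists>g. CFP_feasible u l D n g}. enat n)"

text \<open>Intended for finite subsets \<open>s\<close> of the domain of the corridor.\<close>

definition linearly_compatible ::
  "(real ^ 'm \<Rightarrow> real) \<Rightarrow> (real ^ 'm \<Rightarrow> real) \<Rightarrow> (real ^ 'm) set \<Rightarrow> bool" where
  "linearly_compatible u l s \<longleftrightarrow>
     (\<exists>L. linear_function L \<and> (\<forall>x\<in>convex hull s. l x \<le> L x \<and> L x \<le> u x))"

definition hypergraph :: "'v set \<Rightarrow> 'v set set \<Rightarrow> bool" where
  "hypergraph V E \<longleftrightarrow> finite V \<and> (\<forall>e\<in>E. e \<subseteq> V)"

definition coloring :: "'v set \<Rightarrow> 'v set set \<Rightarrow> nat \<Rightarrow> ('v \<Rightarrow> nat) \<Rightarrow> bool" where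
  "coloring V E n c \<longleftrightarrow> c \<in> V \<rightarrow> {1..n} \<and> (\<forall>e\<in>E. \<not> (\<exists>j. \<forall>v\<in>e. c v = j))"

definition incompatibility_hypergraph ::
  "(real ^ 'm \<Rightarrow> real) \<Rightarrow> (real ^ 'm \<Rightarrow> real) \<Rightarrow> (real ^ 'm) set \<Rightarrow>
   (real ^ 'm) set \<Rightarrow> (real ^ 'm) set set \<Rightarrow> bool" where
  "incompatibility_hypergraph u l D X E \<longleftrightarrow>
     hypergraph X E \<and> X \<subseteq> D \<and> (\<forall>e\<in>E. \<not> linearly_compatible u l e)"

definition color_domain :: "(real ^ 'm) set \<Rightarrow> (real ^ 'm \<Rightarrow> nat) \<Rightarrow> nat \<Rightarrow> (real ^ 'm) set" where
  "color_domain X c j = convex hull {x \<in> X. c x = j}"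

text \<open>\<open>interior\<close> is the interior in the ambient space, so it is empty for a color domain that
  is not full-dimensional.\<close>

definition DCFP_feasible ::
  "(real ^ 'm \<Rightarrow> real) \<Rightarrow> (real ^ 'm \<Rightarrow> real) \<Rightarrow> (real ^ 'm) set \<Rightarrow> (real ^ 'm) set set \<Rightarrow>
   nat \<Rightarrow> (real ^ 'm \<Rightarrow> nat) \<Rightarrow> (nat \<Rightarrow> real ^ 'm \<Rightarrow> real) \<Rightarrow> bool" where
  "DCFP_feasible u l X E n c L \<longleftrightarrow>
     coloring X E n c \<and>
     (\<forall>j\<in>{1..n}. linear_function (L j)) \<and>
     disjoint_family_on (\<lambda>j. interior (color_domain X c j)) {1..n} \<and>
     (\<forall>x\<in>X. l x \<le> L (c x) x \<and> L (c x) x \<le> u x)"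

definition DCFP_value ::
  "(real ^ 'm \<Rightarrow> real) \<Rightarrow> (real ^ 'm \<Rightarrow> real) \<Rightarrow> (real ^ 'm) set \<Rightarrow> (real ^ 'm) set set \<Rightarrow> enat" where
  "DCFP_value u l X E = (INF n\<in>{n. \<exists>c L. DCFP_feasible u l X E n c L}. enat n)"

end

theory Submission imports Defs begin

text \<open>
  A solution \<open>g\<close> of the corridor fitting problem, with pieces \<open>P i\<close> and affine functions \<open>L i\<close>,
  induces a solution of the coloring problem with the same number of colors: each point of \<open>X\<close>
  takes as its color a piece that contains it, and color \<open>i\<close> keeps the affine function \<open>L i\<close>.
  The pieces are convex, so the domain of color \<open>i\<close> lies in \<open>P i\<close> and the interiors stay disjoint.

  The delicate point is a vertex on the boundary of several pieces. Coloring it by a piece that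
  realizes the minimum defining \<open>g\<close> does not work, because pieces may stick out of \<open>D\<close>: a piece
  may meet \<open>D\<close> in boundary points only, and then nothing keeps \<open>L i\<close> inside the corridor on the
  segment between two such points. Instead, \<open>x\<close> is colored by an \<open>i\<close> such that \<open>x\<close> is in the
  closure of \<open>D \<inter> interior (P i)\<close>. Such an \<open>i\<close> exists because \<open>D\<close> is the closure of its interior
  and the boundaries of the pieces are a null set (\<open>cover_by_closures_of_interiors\<close>).
  On \<open>D \<inter> interior (P i)\<close> the function \<open>g\<close> equals \<open>L i\<close>, so by continuity \<open>L i\<close> stays in the
  corridor on the whole closure (\<open>corridor_bounds_on_closure\<close>). That closure is convex, hence it
  contains the convex hull of every set of vertices of color \<open>i\<close>. Every such set is therefore
  linearly compatible and cannot be an edge.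
\<close>

lemma full_dim_polytope_imp_closure_interior:
  fixes D :: "(real ^ 'm) set"
  assumes "full_dim_polytope D"
  shows "closure (interior D) = D"
proof -
  have poly: "polytope D" and dim: "aff_dim D = int DIM(real ^ 'm)"
    using assms by (auto simp: full_dim_polytope_def)
  have conv: "convex D" and cl: "closed D"
    using poly by (simp_all add: polytope_imp_convex polytope_imp_closed)
  have "affine hull D = UNIV"
    using dim aff_dim_eq_full by metis
  then have "interior D = rel_interior D"
    by (simp add: rel_interior_interior)
  moreover have "D \<noteq> {}"
    using dim by auto
  ultimately have "interior D \<noteq> {}"
    using conv by (simp add: rel_interior_eq_empty)
  then show ?thesis
    using conv cl by (simp add: convex_closure_interior)
qed

text \<open>
  A point outside all the closures would have a neighborhood \<open>U\<close> such that the nonempty open set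
  \<open>U \<inter> interior D\<close> is covered by the frontiers of the \<open>P i\<close>. Frontiers of convex sets are null
  sets, and a nonempty open set is not.
\<close>

lemma cover_by_closures_of_interiors:
  fixes D :: "'a::euclidean_space set"
  assumes D: "D \<subseteq> closure (interior D)"
    and "finite I" and conv: "\<And>i. i \<in> I \<Longrightarrow> convex (P i)"
    and cover: "D \<subseteq> (\<Union>i\<in>I. P i)"
  shows "D \<subseteq> (\<Union>i\<in>I. closure (D \<inter> interior (P i)))"
proof
  fix x assume "x \<in> D"
  show "x \<in> (\<Union>i\<in>I. closure (D \<inter> interior (P i)))"
  proof (rule ccontr)
    assume "x \<notin> (\<Union>i\<in>I. closure (D \<inter> interior (P i)))"
    moreover define U where "U = - (\<Union>i\<in>I. closure (D \<inter> interior (P i)))"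
    ultimately have "x \<in> U"
      by simp
    have "open U"
      using \<open>finite I\<close> by (auto simp: U_def open_Compl)
    have "x \<in> closure (interior D)"
      using D \<open>x \<in> D\<close> by blast
    then have "U \<inter> interior D \<noteq> {}"
      using \<open>open U\<close> \<open>x \<in> U\<close> by (metis disjoint_iff open_Int_closure_eq_empty)
    moreover have "negligible (U \<inter> interior D)"
    proof (rule negligible_subset)
      show "negligible (\<Union>i\<in>I. frontier (P i))"
        using \<open>finite I\<close> conv by (auto intro: negligible_convex_frontier)
      show "U \<inter> interior D \<subseteq> (\<Union>i\<in>I. frontier (P i))"
      proof
        fix y assume y: "y \<in> U \<inter> interior D"
        then have "y \<in> D"
          using interior_subset by blast
        then obtain i where i: "i \<in> I" "y \<in> P i"
          using cover by blast
        have "y \<notin> interior (P i)"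
          using y \<open>y \<in> D\<close> i closure_subset[of "D \<inter> interior (P i)"] by (auto simp: U_def)
        then show "y \<in> (\<Union>i\<in>I. frontier (P i))"
          using i closure_subset[of "P i"] by (auto simp: frontier_def)
      qed
    qed
    moreover have "open (U \<inter> interior D)"
      using \<open>open U\<close> by (simp add: open_Int)
    ultimately show False
      using open_not_negligible by metis
  qed
qed

lemma linear_function_continuous_on:
  "linear_function L \<Longrightarrow> continuous_on S L"
  by (auto simp: linear_function_def intro!: continuous_intros)

lemma corridor_bounds_on_closure:
  fixes D :: "(real ^ 'm) set"
  assumes "closed D" and contl: "continuous_on D l" and contu: "continuous_on D u"
    and L: "linear_function L" and "S \<subseteq> D"
    and bounds: "\<And>y. y \<in> S \<Longrightarrow> l y \<le> L y \<and> L y \<le> u y"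
    and x: "x \<in> closure S"
  shows "l x \<le> L x \<and> L x \<le> u x"
proof -
  have sub: "closure S \<subseteq> D"
    using \<open>closed D\<close> \<open>S \<subseteq> D\<close> by (simp add: closure_minimal)
  have cont: "continuous_on (closure S) (\<lambda>y. L y - l y)"
    "continuous_on (closure S) (\<lambda>y. u y - L y)"
    using continuous_on_subset[OF contl sub] continuous_on_subset[OF contu sub]
      linear_function_continuous_on[OF L]
    by (simp_all add: continuous_on_diff)
  have "0 \<le> L x - l x"
    using bounds by (intro continuous_ge_on_closure[OF cont(1) x]) simp
  moreover have "0 \<le> u x - L x"
    using bounds by (intro continuous_ge_on_closure[OF cont(2) x]) simp
  ultimately show ?thesis
    by simp
qed

lemma CFP_feasible_imp_DCFP_feasible:
  fixes u l :: "real ^ 'm \<Rightarrow> real"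
  assumes corr: "corridor u l D"
    and inc: "incompatibility_hypergraph u l D X E"
    and feas: "CFP_feasible u l D n g"
  shows "\<exists>c L. DCFP_feasible u l X E n c L"
proof -
  have D: "full_dim_polytope D" and contu: "continuous_on D u" and contl: "continuous_on D l"
    using corr by (auto simp: corridor_def)
  then have "closed D" "convex D"
    by (auto simp: full_dim_polytope_def polytope_imp_closed polytope_imp_convex)
  have "X \<subseteq> D" and edges: "\<And>e. e \<in> E \<Longrightarrow> e \<subseteq> X \<and> \<not> linearly_compatible u l e"
    using inc by (auto simp: incompatibility_hypergraph_def hypergraph_def)
  have "\<exists>P L. (\<forall>i\<in>{1..n}. full_dim_polytope (P i) \<and> linear_function (L i)) \<and>
      D \<subseteq> (\<Union>i\<in>{1..n}. P i) \<and> disjoint_family_on (\<lambda>i. interior (P i)) {1..n} \<and>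
      (\<forall>x\<in>D. \<forall>i\<in>{1..n}. x \<in> interior (P i) \<longrightarrow> g x = L i x)"
    using feas unfolding CFP_feasible_def piecewise_linear_def
    by (elim conjE exE) (intro exI conjI, assumption+, blast)
  then obtain P L where PL: "\<forall>i\<in>{1..n}. full_dim_polytope (P i) \<and> linear_function (L i)"
    and cover: "D \<subseteq> (\<Union>i\<in>{1..n}. P i)"
    and disj: "disjoint_family_on (\<lambda>i. interior (P i)) {1..n}"
    and gL: "\<forall>x\<in>D. \<forall>i\<in>{1..n}. x \<in> interior (P i) \<longrightarrow> g x = L i x"
    by (elim exE conjE) (rule that)
  have P: "full_dim_polytope (P i)" and L: "linear_function (L i)" if "i \<in> {1..n}" for i
    using PL that by blast+
  have g: "\<And>x. x \<in> D \<Longrightarrow> l x \<le> g x \<and> g x \<le> u x"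
    using feas by (simp add: CFP_feasible_def)
  have convP: "convex (P i)" and closedP: "closed (P i)" if "i \<in> {1..n}" for i
    using P[OF that] by (auto simp: full_dim_polytope_def polytope_imp_closed polytope_imp_convex)
  define Q where "Q i = closure (D \<inter> interior (P i))" for i
  have convQ: "convex (Q i)" if "i \<in> {1..n}" for i
    unfolding Q_def using \<open>convex D\<close> convP[OF that] by (simp add: convex_Int convex_closure)
  have QP: "Q i \<subseteq> P i" if "i \<in> {1..n}" for i
    unfolding Q_def using closedP[OF that] interior_subset[of "P i"]
    by (intro closure_minimal) auto
  have bounds: "l x \<le> L i x \<and> L i x \<le> u x" if i: "i \<in> {1..n}" and "x \<in> Q i" for i x
  proof (rule corridor_bounds_on_closure[OF \<open>closed D\<close> contl contu L[OF i]])
    show "x \<in> closure (D \<inter> interior (P i))"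
      using \<open>x \<in> Q i\<close> by (simp add: Q_def)
    show "l y \<le> L i y \<and> L i y \<le> u y" if "y \<in> D \<inter> interior (P i)" for y
      using that g[of y] gL i by (metis IntD1 IntD2)
  qed simp
  have "D \<subseteq> (\<Union>i\<in>{1..n}. Q i)"
    unfolding Q_def
    using full_dim_polytope_imp_closure_interior[OF D] convP cover
    by (intro cover_by_closures_of_interiors) auto
  then have "\<forall>x\<in>X. \<exists>i\<in>{1..n}. x \<in> Q i"
    using \<open>X \<subseteq> D\<close> by blast
  then obtain c where c: "\<And>x. x \<in> X \<Longrightarrow> c x \<in> {1..n} \<and> x \<in> Q (c x)"
    by metis
  have hull: "convex hull e \<subseteq> Q j" if "j \<in> {1..n}" "e \<subseteq> X" "\<And>v. v \<in> e \<Longrightarrow> c v = j" for e j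
    using that c convQ[of j] by (intro hull_minimal) auto
  have "coloring X E n c"
    unfolding coloring_def
  proof (intro conjI ballI notI)
    show "c \<in> X \<rightarrow> {1..n}"
      using c by blast
  next
    fix e assume "e \<in> E" and "\<exists>j. \<forall>v\<in>e. c v = j"
    then obtain j where j: "\<And>v. v \<in> e \<Longrightarrow> c v = j"
      by blast
    have "e \<subseteq> X" and incompat: "\<not> linearly_compatible u l e"
      using edges[OF \<open>e \<in> E\<close>] by auto
    \<comment> \<open>The empty set is linearly compatible, so \<open>e\<close> has a vertex and \<open>j\<close> is a genuine color.\<close>
    have "e \<noteq> {}"
    proof
      assume "e = {}"
      then have "linearly_compatible u l e"
        by (auto simp: linearly_compatible_def linear_function_def)
      then show False
        using incompat by simp
    qed
    then have "j \<in> {1..n}"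
      using j c \<open>e \<subseteq> X\<close> by blast
    then have "linearly_compatible u l e"
      unfolding linearly_compatible_def
      using hull[OF _ \<open>e \<subseteq> X\<close> j] bounds L by blast
    then show False
      using incompat by simp
  qed
  moreover have "disjoint_family_on (\<lambda>j. interior (color_domain X c j)) {1..n}"
  proof -
    have "color_domain X c j \<subseteq> P j" if "j \<in> {1..n}" for j
    proof -
      have "color_domain X c j \<subseteq> Q j"
        unfolding color_domain_def by (rule hull[OF that]) auto
      then show ?thesis
        using QP[OF that] by (rule subset_trans)
    qed
    then have "interior (color_domain X c j) \<subseteq> interior (P j)" if "j \<in> {1..n}" for j
      using that by (simp add: interior_mono)
    then show ?thesis
      using disj unfolding disjoint_family_on_def by blast
  qed
  ultimately have "DCFP_feasible u l X E n c L"
    using L c bounds by (simp add: DCFP_feasible_def)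
  then show ?thesis
    by blast
qed

theorem proposition12:
  fixes u l :: "real ^ 'm \<Rightarrow> real"
    and D X :: "(real ^ 'm) set"
    and E :: "(real ^ 'm) set set"
  assumes "corridor u l D"
    and "finite X" and "X \<subseteq> D"
    and "incompatibility_hypergraph u l D X E"
  shows "DCFP_value u l X E \<le> CFP_value u l D"
proof -
  have "{n. \<exists>g. CFP_feasible u l D n g} \<subseteq> {n. \<exists>c L. DCFP_feasible u l X E n c L}"
    using CFP_feasible_imp_DCFP_feasible[OF assms(1,4)] by blast
  then show ?thesis
    unfolding DCFP_value_def CFP_value_def by (rule INF_superset_mono) simp
qed

end
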